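(* Let $d\geq 1$ and $\alpha\geq 2$ be integers, and set $n=2d+1$ (so $n\geq3$). Let $\|(z,t)\|_\alpha=(|z|^\alpha+|t|^{\alpha/2})^{1/\alpha}$ for $(z,t)\in\mathbb{R}^{2d}\times\mathbb{R}$. Then, for $R>1$ and $0\leq \delta<1$, $$\#\big(\{m\in\mathbb{Z}^{2d}\times\mathbb{Z}: R-\delta\leq\|m\|_\alpha\leq R+\delta\}\big)\sim R^n\delta$$ in each of the following cases: (i) $\alpha\geq2(n-1)$ and $\delta\geq R^{-\frac{1}{\alpha-1}}$; (ii) $2<\alpha\leq2(n-1)$ and $\delta\geq R^{-\frac{1}{2n-3}}$; (iii) $\alpha=2$ and $\delta\geq R^{-\frac{n-2}{n}}$.
   Context: $|z|$ is the Euclidean norm of $z\in\mathbb{R}^{2d}$, and $\#(\cdot)$ denotes the cardinality of a finite set. $x\lesssim y$ means $x\leq Cy$ for some constant $C>0$, and $x\sim y$ means both $x\lesssim y$ and $y\lesssim x$; here the constants may depend on $d$ and $\alpha$ but not on $R$ or $\delta$. *)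

theory Defs
  imports "HOL-Analysis.Analysis"
begin

text \<open>
  The space \<open>\<real>\<^sup>2\<^sup>d \<times> \<real>\<close> is the type \<open>(real ^ 'n) \<times> real\<close> with \<open>CARD('n) = 2 * d\<close>;
  \<open>norm\<close> on \<open>real ^ 'n\<close> is the Euclidean norm. Note that \<open>0 powr a = 0\<close>, so \<open>powr\<close>
  agrees with the usual power on all nonnegative bases for the positive exponents used here.
\<close>

definition alpha_norm :: "nat \<Rightarrow> (real ^ 'n) \<times> real \<Rightarrow> real" where
  "alpha_norm \<alpha> p =
     (norm (fst p) ^ \<alpha> + \<bar>snd p\<bar> powr (real \<alpha> / 2)) powr (1 / real \<alpha>)"

definition int_lattice :: "((real ^ 'n) \<times> real) set" where
  "int_lattice = {m. (\<forall>i. fst m $ i \<in> \<int>) \<and> snd m \<in> \<int>}"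

text \<open>
  \<open>card\<close> of an infinite set is \<open>0\<close>; a lower bound \<open>R ^ n * \<delta> \<le> C * card \<dots>\<close> with
  \<open>R, \<delta> > 0\<close> therefore also says that the shell is finite and nonempty.
\<close>

definition lattice_shell :: "nat \<Rightarrow> real \<Rightarrow> real \<Rightarrow> ((real ^ 'n) \<times> real) set" where
  "lattice_shell \<alpha> R \<delta> =
     {m \<in> int_lattice. R - \<delta> \<le> alpha_norm \<alpha> m \<and> alpha_norm \<alpha> m \<le> R + \<delta>}"

text \<open>
  \<open>lesssim_on S f g\<close> and \<open>sim_on S f g\<close> are the relations \<open>f \<lesssim> g\<close> and \<open>f \<sim> g\<close> with one
  constant valid for all parameters in \<open>S\<close>. This is not asymptotic equivalence:
  the bounds hold on all of \<open>S\<close>, without a limit.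
\<close>

definition lesssim_on :: "'a set \<Rightarrow> ('a \<Rightarrow> real) \<Rightarrow> ('a \<Rightarrow> real) \<Rightarrow> bool" where
  "lesssim_on S f g \<longleftrightarrow> (\<exists>C>0. \<forall>x\<in>S. f x \<le> C * g x)"

definition sim_on :: "'a set \<Rightarrow> ('a \<Rightarrow> real) \<Rightarrow> ('a \<Rightarrow> real) \<Rightarrow> bool" where
  "sim_on S f g \<longleftrightarrow> lesssim_on S f g \<and> lesssim_on S g f"

end

theory Submission imports Defs begin

text \<open>
  The shell is counted by slicing it over the integer points \<open>z\<close> of the horizontal space, whose
  dimension is written \<open>D\<close> (so \<open>D = 2 * d\<close> and \<open>n = D + 1\<close>). Put \<open>a = R - \<delta>\<close>, \<open>b = R + \<delta>\<close> and
  \<open>p = 2 / \<alpha> \<le> 1\<close>. The condition on \<open>t\<close> says that \<open>\<bar>t\<bar>\<close> lies between \<open>(a ^ \<alpha> - norm z ^ \<alpha>) powr p\<close> and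
  \<open>(b ^ \<alpha> - norm z ^ \<alpha>) powr p\<close>, where the first base is replaced by 0 if it is negative. Up to an error \<open>O(1)\<close>, the number of
  integers \<open>t\<close> over \<open>z\<close> is the length of this range, and these errors add up to \<open>O(R ^ D)\<close>,
  which is \<open>O(R ^ n * \<delta>)\<close> as soon as \<open>R * \<delta> \<ge> 1\<close>. All three cases imply that inequality.

  For the lower bound, concavity of \<open>x powr p\<close> shows that the part of a fibre between the radii \<open>R\<close> and \<open>R + \<delta>\<close>
  has length at least \<open>(R + \<delta>)\<^sup>2 - R\<^sup>2 \<ge> 2 * R * \<delta>\<close>, and there are at least a constant
  times \<open>R ^ D\<close> base points \<open>z\<close> with \<open>norm z \<le> R / 2\<close> (\<open>card_lattice_shell_ge\<close>).

  For the upper bound, the difficulty is that for \<open>\<alpha> > 2\<close> the lengths are not \<open>O(R * \<delta>)\<close> uniformly as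
  \<open>norm z\<close> approaches \<open>R\<close>, so that they have to be averaged. The base points are grouped into spherical shells \<open>j \<le> norm z < j + 1\<close>. Each contains
  \<open>O(R ^ (D - 1))\<close> of them (\<open>card_int_shell_le\<close>). If \<open>a - norm z\<close> is of size \<open>k \<ge> 1\<close>, the
  tangent bound for \<open>x powr p\<close> makes the length \<open>O(R powr (2 - p) * \<delta> * k powr (p - 1))\<close>, and the sum over
  \<open>k \<le> R\<close> is \<open>O(R\<^sup>2 * \<delta>)\<close>. In the boundedly many remaining shells, subadditivity of \<open>x powr p\<close> makes the length
  \<open>O(R powr (2 - p) * \<delta> powr p)\<close>, which is \<open>O(R\<^sup>2 * \<delta>)\<close> if \<open>R powr - p \<le> \<delta> powr (1 - p)\<close>. For
  \<open>\<delta> \<ge> R powr - \<kappa>\<close> this holds when \<open>\<kappa> * (\<alpha> - 2) \<le> 2\<close>, and the three exponents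
  \<open>1 / (\<alpha> - 1)\<close>, \<open>1 / (2 * n - 3)\<close> and \<open>(n - 2) / n\<close> satisfy this in their respective ranges of \<open>\<alpha>\<close>
  (\<open>card_lattice_shell_le\<close>, \<open>sim_on_lattice_shell\<close>).
\<close>

section \<open>Integers in intervals\<close>

lemma Ints_Icc_eq_image: "{t::real. t \<in> \<int> \<and> a \<le> t \<and> t \<le> b} = of_int ` {\<lceil>a\<rceil>..\<lfloor>b\<rfloor>}"
  by (auto simp: Ints_def le_floor_iff ceiling_le_iff)

lemma finite_Ints_Icc: "finite {t::real. t \<in> \<int> \<and> a \<le> t \<and> t \<le> b}"
  by (simp add: Ints_Icc_eq_image)

lemma card_Ints_Icc:
  "real (card {t::real. t \<in> \<int> \<and> a \<le> t \<and> t \<le> b}) = real (nat (\<lfloor>b\<rfloor> - \<lceil>a\<rceil> + 1))"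
  by (simp add: Ints_Icc_eq_image card_image inj_on_def)

lemma card_Ints_Icc_le:
  assumes "a \<le> b"
  shows "real (card {t::real. t \<in> \<int> \<and> a \<le> t \<and> t \<le> b}) \<le> b - a + 1"
  unfolding card_Ints_Icc using assms by linarith

lemma card_Ints_Icc_ge:
  "b - a - 1 \<le> real (card {t::real. t \<in> \<int> \<and> a \<le> t \<and> t \<le> b})"
  unfolding card_Ints_Icc by linarith

lemma Ints_abs_Icc_subset:
  "{t::real. t \<in> \<int> \<and> a \<le> \<bar>t\<bar> \<and> \<bar>t\<bar> \<le> b} \<subseteq>
     {t. t \<in> \<int> \<and> a \<le> t \<and> t \<le> b} \<union> {t. t \<in> \<int> \<and> - b \<le> t \<and> t \<le> - a}"
  by auto

lemma finite_Ints_abs_Icc: "finite {t::real. t \<in> \<int> \<and> a \<le> \<bar>t\<bar> \<and> \<bar>t\<bar> \<le> b}"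
  by (rule finite_subset[OF Ints_abs_Icc_subset]) (simp add: finite_Ints_Icc)

lemma card_Ints_abs_Icc_le:
  assumes "a \<le> b"
  shows "real (card {t::real. t \<in> \<int> \<and> a \<le> \<bar>t\<bar> \<and> \<bar>t\<bar> \<le> b}) \<le> 2 * (b - a + 1)"
proof -
  let ?P = "{t::real. t \<in> \<int> \<and> a \<le> t \<and> t \<le> b}" and ?N = "{t::real. t \<in> \<int> \<and> - b \<le> t \<and> t \<le> - a}"
  have "card {t::real. t \<in> \<int> \<and> a \<le> \<bar>t\<bar> \<and> \<bar>t\<bar> \<le> b} \<le> card (?P \<union> ?N)"
    by (intro card_mono Ints_abs_Icc_subset) (simp add: finite_Ints_Icc)
  also have "\<dots> \<le> card ?P + card ?N"
    by (rule card_Un_le)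
  finally have "real (card {t::real. t \<in> \<int> \<and> a \<le> \<bar>t\<bar> \<and> \<bar>t\<bar> \<le> b}) \<le> real (card ?P) + real (card ?N)"
    by linarith
  with card_Ints_Icc_le[of a b] card_Ints_Icc_le[of "-b" "-a"] assms show ?thesis
    by simp
qed

section \<open>Integer vectors in balls\<close>

definition int_vecs :: "(real ^ 'n) set" where
  "int_vecs = {z. \<forall>i. z $ i \<in> \<int>}"

lemma vec_Pi_eq_image: "{z :: real ^ 'n. \<forall>i. z $ i \<in> S i} = vec_lambda ` (PiE UNIV S)"
proof -
  have "z \<in> vec_lambda ` (PiE UNIV S)" if "\<forall>i. z $ i \<in> S i" for z :: "real ^ 'n"
    using that by (intro image_eqI[of _ _ "vec_nth z"]) auto
  then show ?thesis
    by auto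
qed

lemma finite_vec_Pi:
  assumes "\<And>i. finite (S i)"
  shows "finite {z :: real ^ 'n. \<forall>i. z $ i \<in> S i}"
  unfolding vec_Pi_eq_image using assms by (intro finite_imageI finite_PiE) auto

lemma card_vec_Pi: "card {z :: real ^ 'n. \<forall>i. z $ i \<in> S i} = (\<Prod>i\<in>UNIV. card (S i))"
  unfolding vec_Pi_eq_image by (subst card_image) (auto simp: inj_on_def card_PiE vec_lambda_inject)

lemma int_box_eq:
  "{z \<in> int_vecs. \<forall>i. \<bar>z $ i\<bar> \<le> r} = {z :: real ^ 'n. \<forall>i. z $ i \<in> {t. t \<in> \<int> \<and> - r \<le> t \<and> t \<le> r}}"
  by (auto simp: int_vecs_def abs_le_iff minus_le_iff)

lemma finite_int_vecs_norm_le: "finite {z \<in> int_vecs :: (real ^ 'n) set. norm z \<le> r}"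
proof (rule finite_subset)
  show "{z \<in> int_vecs :: (real ^ 'n) set. norm z \<le> r} \<subseteq> {z \<in> int_vecs. \<forall>i. \<bar>z $ i\<bar> \<le> r}"
    using component_le_norm_cart order_trans by blast
  show "finite {z \<in> int_vecs :: (real ^ 'n) set. \<forall>i. \<bar>z $ i\<bar> \<le> r}"
    unfolding int_box_eq by (intro finite_vec_Pi finite_Ints_Icc)
qed

text \<open>The cube of half-width \<open>r / D\<close>, where \<open>D\<close> is the dimension, lies in the ball of radius \<open>r\<close>.
  A symmetric interval of half-width \<open>x\<close> contains at least \<open>x\<close> integers even for \<open>x < 1\<close>, because
  it contains 0; hence the bound holds for all \<open>r \<ge> 0\<close>, down to radii that see only the origin.\<close>

lemma card_int_ball_ge:
  assumes "r \<ge> 0"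
  shows "(r / real CARD('n)) ^ CARD('n) \<le> real (card {z \<in> int_vecs :: (real ^ 'n) set. norm z \<le> r})"
proof -
  define x where "x = r / real CARD('n)"
  let ?I = "{t::real. t \<in> \<int> \<and> - x \<le> t \<and> t \<le> x}"
  have x: "x \<ge> 0" using assms by (simp add: x_def)
  have "x \<le> real (card ?I)"
  proof (cases "x < 1")
    case True
    have "card {0::real} \<le> card ?I"
      using x by (intro card_mono finite_Ints_Icc) auto
    with True show ?thesis by simp
  next
    case False
    with card_Ints_Icc_ge[of x "-x"] show ?thesis by simp
  qed
  then have "x ^ CARD('n) \<le> real (card ?I) ^ CARD('n)"
    using x by (intro power_mono)
  also have "\<dots> = real (card {z \<in> int_vecs :: (real ^ 'n) set. \<forall>i. \<bar>z $ i\<bar> \<le> x})"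
    unfolding int_box_eq card_vec_Pi by simp
  also have "\<dots> \<le> real (card {z \<in> int_vecs :: (real ^ 'n) set. norm z \<le> r})"
  proof -
    have "norm z \<le> r" if "\<forall>i. \<bar>z $ i\<bar> \<le> x" for z :: "real ^ 'n"
    proof -
      have "norm z \<le> (\<Sum>i\<in>UNIV. \<bar>z $ i\<bar>)" by (rule norm_le_l1_cart)
      also have "\<dots> \<le> (\<Sum>i\<in>(UNIV::'n set). x)" using that by (intro sum_mono) auto
      also have "\<dots> = r" by (simp add: x_def)
      finally show ?thesis .
    qed
    then show ?thesis
      by (intro of_nat_mono card_mono finite_int_vecs_norm_le) auto
  qed
  finally show ?thesis by (simp add: x_def)
qed

section \<open>Integer vectors in spherical shells of width one\<close>

lemma card_le_fibres:
  assumes "finite S" "finite T" "f ` S \<subseteq> T"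
    and "\<And>t. t \<in> T \<Longrightarrow> real (card {x \<in> S. f x = t}) \<le> K"
  shows "real (card S) \<le> K * real (card T)"
proof -
  have "S = (\<Union>t\<in>T. {x \<in> S. f x = t})" using assms(3) by auto
  then have "card S \<le> (\<Sum>t\<in>T. card {x \<in> S. f x = t})"
    using card_UN_le[OF assms(2), of "\<lambda>t. {x \<in> S. f x = t}"] by simp
  then have "real (card S) \<le> (\<Sum>t\<in>T. real (card {x \<in> S. f x = t}))"
    by (simp only: of_nat_le_iff flip: of_nat_sum)
  also have "\<dots> \<le> (\<Sum>t\<in>T. K)" by (intro sum_mono assms(4))
  finally show ?thesis by (simp add: mult.commute)
qed

text \<open>The absolute values lie within \<open>w\<close> of any fixed one of them, hence \<open>X\<close> lies in two
  intervals of length \<open>2 * w\<close>, one for each sign.\<close>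

lemma card_Ints_abs_close_le:
  fixes X :: "real set"
  assumes "X \<subseteq> \<int>" "w \<ge> 0" and close: "\<And>x y. x \<in> X \<Longrightarrow> y \<in> X \<Longrightarrow> \<bar>x\<bar> - \<bar>y\<bar> \<le> w"
  shows "real (card X) \<le> 4 * w + 2"
proof (cases "X = {}")
  case False
  then obtain y where y: "y \<in> X" by auto
  let ?Y = "{t::real. t \<in> \<int> \<and> \<bar>y\<bar> - w \<le> \<bar>t\<bar> \<and> \<bar>t\<bar> \<le> \<bar>y\<bar> + w}"
  have "X \<subseteq> ?Y"
    using assms(1) close[OF y] close[OF _ y] by (force simp: algebra_simps)
  then have "card X \<le> card ?Y"
    by (intro card_mono finite_Ints_abs_Icc)
  with card_Ints_abs_Icc_le[of "\<bar>y\<bar> - w" "\<bar>y\<bar> + w"] assms(2) show ?thesis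
    by simp
qed (use assms in auto)

lemma norm_eq_replace_coordinate:
  fixes z :: "real ^ 'n"
  shows "(norm z)\<^sup>2 = (z $ i)\<^sup>2 + (norm (\<chi> k. if k = i then 0 else z $ k))\<^sup>2"
proof -
  have "(norm z)\<^sup>2 = (\<Sum>k\<in>UNIV. (z $ k)\<^sup>2)" for z :: "real ^ 'n"
    by (simp add: norm_vec_def L2_set_def sum_nonneg)
  moreover have "(\<Sum>k\<in>UNIV. ((\<chi> k. if k = i then 0 else z $ k) $ k)\<^sup>2) = (\<Sum>k\<in>UNIV - {i}. (z $ k)\<^sup>2)"
    by (rule sum.mono_neutral_cong_right) auto
  ultimately show ?thesis
    by (simp add: sum.remove[of UNIV i])
qed

text \<open>On the part of the shell where the coordinate \<open>i\<close> is at least a fixed proportion of the radius,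
  the sphere is uniformly transversal to the \<open>i\<close>-axis. Fixing the other coordinates determines the square of
  the \<open>i\<close>-th one up to \<open>2 * j + 1\<close>, and dividing by its size determines its absolute value up to
  a constant that depends only on the dimension. So there are boundedly many points over each of
  the \<open>O(j ^ (D - 1))\<close> choices of the other coordinates.\<close>

lemma card_int_shell_coordinate_le:
  fixes j :: nat and i :: "'n::finite"
  assumes j: "j \<ge> 1"
  defines "S \<equiv> {z \<in> int_vecs :: (real ^ 'n) set. real j \<le> norm z \<and> norm z < real j + 1
                   \<and> real j / real CARD('n) \<le> \<bar>z $ i\<bar>}"
  shows "real (card S) \<le> (6 * real CARD('n) + 2) * (2 * real j + 3) ^ (CARD('n) - 1)"
proof -
  let ?D = "real CARD('n)"
  define f where "f = (\<lambda>z :: real ^ 'n. (\<chi> k. if k = i then 0 else z $ k) :: real ^ 'n)"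
  define I where "I = (\<lambda>k. if k = i then {0} else {t::real. t \<in> \<int> \<and> - (real j + 1) \<le> t \<and> t \<le> real j + 1})"
  define T where "T = {z :: real ^ 'n. \<forall>k. z $ k \<in> I k}"
  have "S \<subseteq> {z \<in> int_vecs. norm z \<le> real j + 1}"
    by (auto simp: S_def)
  then have finS: "finite S"
    using finite_int_vecs_norm_le finite_subset by blast
  have finT: "finite T"
    unfolding T_def by (intro finite_vec_Pi) (simp add: I_def finite_Ints_Icc)
  have fST: "f ` S \<subseteq> T"
  proof -
    have "z $ k \<in> \<int> \<and> - (real j + 1) \<le> z $ k \<and> z $ k \<le> real j + 1" if "z \<in> S" for z k
      using component_le_norm_cart[of z k] that by (auto simp: S_def int_vecs_def)
    then show ?thesis
      by (auto simp: T_def I_def f_def)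
  qed
  have "real (card {z \<in> S. f z = w}) \<le> 6 * ?D + 2" for w
  proof -
    let ?X = "(\<lambda>z. z $ i) ` {z \<in> S. f z = w}"
    have "inj_on (\<lambda>z. z $ i) {z \<in> S. f z = w}"
    proof (rule inj_onI)
      fix x y assume "x \<in> {z \<in> S. f z = w}" "y \<in> {z \<in> S. f z = w}" and eq: "x $ i = y $ i"
      then have "f x $ k = f y $ k" for k by simp
      then have "(if k = i then 0 else x $ k) = (if k = i then 0 else y $ k)" for k
        by (simp only: f_def vec_lambda_beta)
      with eq have "x $ k = y $ k" for k
        by (cases "k = i") (auto dest: meta_spec[of _ k])
      then show "x = y" by (simp add: vec_eq_iff)
    qed
    then have "card {z \<in> S. f z = w} = card ?X"
      by (simp add: card_image)
    also have "real (card ?X) \<le> 4 * (3 * ?D / 2) + 2"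
    proof (rule card_Ints_abs_close_le)
      show "?X \<subseteq> \<int>" by (auto simp: S_def int_vecs_def)
      fix x y assume "x \<in> ?X" "y \<in> ?X"
      then obtain u v where u: "u \<in> S" "f u = w" "x = u $ i" and v: "v \<in> S" "f v = w" "y = v $ i"
        by auto
      have "(norm u)\<^sup>2 \<le> (real j + 1)\<^sup>2" "(real j)\<^sup>2 \<le> (norm v)\<^sup>2"
        using u(1) v(1) by (auto simp: S_def intro!: power_mono)
      moreover have "(norm u)\<^sup>2 = x\<^sup>2 + (norm w)\<^sup>2" "(norm v)\<^sup>2 = y\<^sup>2 + (norm w)\<^sup>2"
        using norm_eq_replace_coordinate[of u i] norm_eq_replace_coordinate[of v i] u v
        by (auto simp: f_def)
      ultimately have "x\<^sup>2 - y\<^sup>2 \<le> (real j + 1)\<^sup>2 - (real j)\<^sup>2" by linarith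
      then have *: "(\<bar>x\<bar> - \<bar>y\<bar>) * (\<bar>x\<bar> + \<bar>y\<bar>) \<le> 2 * real j + 1"
        by (simp add: power2_eq_square algebra_simps)
      have xy: "real j / ?D \<le> \<bar>x\<bar>" "real j / ?D \<le> \<bar>y\<bar>"
        using u v by (auto simp: S_def)
      show "\<bar>x\<bar> - \<bar>y\<bar> \<le> 3 * ?D / 2"
      proof (rule ccontr)
        assume "\<not> ?thesis"
        \<comment> \<open>The left-hand side is 3 j, which is at least 2 j + 1 because j \<ge> 1.\<close>
        then have "(3 * ?D / 2) * (2 * real j / ?D) < (\<bar>x\<bar> - \<bar>y\<bar>) * (\<bar>x\<bar> + \<bar>y\<bar>)"
          using xy j by (intro mult_strict_mono') auto
        with * j show False by simp
      qed
    qed simp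
    finally show ?thesis by simp
  qed
  then have "real (card S) \<le> (6 * ?D + 2) * real (card T)"
    using finS finT fST by (intro card_le_fibres)
  also have "real (card T) \<le> (2 * real j + 3) ^ (CARD('n) - 1)"
  proof -
    have "real (card T) = (\<Prod>k\<in>UNIV. real (card (I k)))"
      by (simp add: T_def card_vec_Pi)
    also have "\<dots> = (\<Prod>k\<in>UNIV - {i}. real (card (I k)))"
      by (subst prod.remove[of UNIV i]) (auto simp: I_def)
    also have "\<dots> \<le> (\<Prod>k\<in>UNIV - {i}. 2 * real j + 3)"
      using card_Ints_Icc_le[of "- (real j + 1)" "real j + 1"]
      by (intro prod_mono) (auto simp: I_def)
    finally show ?thesis by (simp add: card_Diff_singleton)
  qed
  finally show ?thesis by (simp add: mult_left_mono)
qed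

text \<open>A vector of norm at least \<open>j\<close> has a coordinate of size at least \<open>j / D\<close>, so the shell is the
  union of \<open>D\<close> transversal pieces. The order of magnitude \<open>(j + 1) ^ (D - 1)\<close> is the volume of the shell,
  with no loss; for thinner shells such an estimate would require arithmetic information, but width 1 is
  all that is needed here.\<close>

lemma card_int_shell_le:
  fixes j :: nat
  shows "real (card {z \<in> int_vecs :: (real ^ 'n) set. real j \<le> norm z \<and> norm z < real j + 1})
    \<le> real CARD('n) * (6 * real CARD('n) + 2) * 3 ^ (CARD('n) - 1) * (real j + 1) ^ (CARD('n) - 1)"
    (is "real (card ?S) \<le> ?C * _")
proof (cases "j = 0")
  case True
  have "z = 0" if "z \<in> int_vecs" "norm z < 1" for z :: "real ^ 'n"
  proof -
    have "z $ i = 0" for i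
      using that component_le_norm_cart[of z i] Ints_nonzero_abs_less1[of "z $ i"] by (auto simp: int_vecs_def)
    then show ?thesis by (simp add: vec_eq_iff)
  qed
  then have "?S \<subseteq> {0}" using True by auto
  then have "card ?S \<le> card {0::real^'n}" by (intro card_mono) auto
  also have "real (card {0::real^'n}) \<le> 1 * 1 * 1 * 1" by simp
  also have "\<dots> \<le> ?C * (real j + 1) ^ (CARD('n) - 1)"
    by (intro mult_mono) (auto simp: Suc_le_eq)
  finally show ?thesis by simp
next
  case False
  let ?D = "real CARD('n)"
  let ?F = "\<lambda>i. {z \<in> int_vecs :: (real ^ 'n) set. real j \<le> norm z \<and> norm z < real j + 1
                   \<and> real j / ?D \<le> \<bar>z $ i\<bar>}"
  have "\<exists>i. real j / ?D \<le> \<bar>z $ i\<bar>" if "real j \<le> norm z" for z :: "real ^ 'n"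
  proof (rule ccontr)
    assume "\<nexists>i. real j / ?D \<le> \<bar>z $ i\<bar>"
    then have "(\<Sum>i\<in>UNIV. \<bar>z $ i\<bar>) < (\<Sum>i\<in>(UNIV::'n set). real j / ?D)"
      by (intro sum_strict_mono) (auto simp: not_le)
    also have "\<dots> = real j" by simp
    finally show False
      using norm_le_l1_cart[of z] that by linarith
  qed
  then have "?S = (\<Union>i\<in>UNIV. ?F i)" by auto
  then have "card ?S \<le> (\<Sum>i\<in>UNIV. card (?F i))"
    using card_UN_le[of UNIV ?F] by simp
  then have "real (card ?S) \<le> (\<Sum>i\<in>UNIV. real (card (?F i)))"
    by (simp only: of_nat_le_iff flip: of_nat_sum)
  also have "\<dots> \<le> (\<Sum>i\<in>(UNIV::'n set). (6 * ?D + 2) * (2 * real j + 3) ^ (CARD('n) - 1))"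
    using False by (intro sum_mono card_int_shell_coordinate_le) auto
  also have "\<dots> = ?D * (6 * ?D + 2) * (2 * real j + 3) ^ (CARD('n) - 1)"
    by (simp only: sum_constant mult.assoc)
  also have "\<dots> \<le> ?D * (6 * ?D + 2) * (3 * (real j + 1)) ^ (CARD('n) - 1)"
    by (intro mult_left_mono power_mono) auto
  finally show ?thesis
    by (simp only: power_mult_distrib mult.assoc)
qed

section \<open>Inequalities for powers\<close>

text \<open>Concavity of \<open>x powr p\<close>: the graph lies below its tangents. For \<open>y > 0\<close> this is the weighted
  inequality between the arithmetic and the geometric mean of \<open>y\<close> and \<open>x\<close>, divided by \<open>x powr (1 - p)\<close>.\<close>

lemma powr_le_tangent:
  fixes x y p :: real
  assumes "x > 0" "y \<ge> 0" "0 < p" "p \<le> 1"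
  shows "y powr p \<le> x powr p + p * x powr (p - 1) * (y - x)"
proof (cases "y = 0")
  case True
  have "x powr (p - 1) * x = x powr p" using assms by (simp add: powr_mult_base mult.commute)
  then have "x powr p + p * x powr (p - 1) * (y - x) = (1 - p) * x powr p"
    using True by (simp add: algebra_simps)
  with True assms show ?thesis by simp
next
  case False
  then have "y powr p * x powr (1 - p) \<le> p * y + (1 - p) * x"
    using assms by (intro Youngs_inequality_0) auto
  then have "y powr p * x powr (1 - p) * x powr (p - 1) \<le> (p * y + (1 - p) * x) * x powr (p - 1)"
    by (intro mult_right_mono) auto
  moreover have "x powr (1 - p) * x powr (p - 1) = 1"
    using assms by (simp flip: powr_add)
  moreover have "x powr (p - 1) * x = x powr p" using assms by (simp add: powr_mult_base mult.commute)
  ultimately show ?thesis by (simp add: algebra_simps)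
qed

lemma powr_subadditive:
  fixes x h p :: real
  assumes "x \<ge> 0" "h \<ge> 0" "0 < p" "p \<le> 1"
  shows "(x + h) powr p \<le> x powr p + h powr p"
proof (cases "x + h = 0")
  case False
  then have pos: "x + h > 0" using assms by auto
  have *: "u / (x + h) * (x + h) powr p \<le> u powr p" if "0 \<le> u" "u \<le> x + h" for u
  proof -
    have "u / (x + h) = (u / (x + h)) powr 1" using pos that by simp
    also have "\<dots> \<le> (u / (x + h)) powr p" using pos that assms by (intro powr_mono') auto
    also have "\<dots> = u powr p / (x + h) powr p" using pos that by (simp add: powr_divide)
    finally show ?thesis using pos by (simp add: pos_le_divide_eq)
  qed
  have "(x + h) powr p = x / (x + h) * (x + h) powr p + h / (x + h) * (x + h) powr p"
    using pos by (simp flip: distrib_right add_divide_distrib)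
  with *[of x] *[of h] assms show ?thesis by simp
qed simp

text \<open>Increments of a concave function decrease. This is what makes the vertical fibre over \<open>z\<close> at
  least as long as the one over the origin.\<close>

lemma powr_diff_antimono:
  fixes x y h p :: real
  assumes "0 < x" "x \<le> y" "h \<ge> 0" "0 < p" "p \<le> 1"
  shows "(y + h) powr p - y powr p \<le> (x + h) powr p - x powr p"
proof (rule DERIV_nonpos_imp_nonincreasing[OF \<open>x \<le> y\<close>])
  fix u assume "x \<le> u" "u \<le> y"
  then have u: "u > 0" using assms by simp
  have "((\<lambda>u. (u + h) powr p - u powr p) has_real_derivative p * (u + h) powr (p - 1) - p * u powr (p - 1)) (at u)"
    using u assms by (auto intro!: derivative_eq_intros)
  moreover have "(u + h) powr (p - 1) \<le> u powr (p - 1)"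
    using u assms by (intro powr_mono2') auto
  ultimately show "\<exists>D. ((\<lambda>u. (u + h) powr p - u powr p) has_real_derivative D) (at u) \<and> D \<le> 0"
    using assms by (intro exI[of _ "p * (u + h) powr (p - 1) - p * u powr (p - 1)"]) (auto intro: mult_left_mono)
qed

lemma power_diff_le:
  fixes a b :: real
  assumes "0 \<le> b" "b \<le> a"
  shows "a ^ k - b ^ k \<le> real k * a ^ (k - 1) * (a - b)"
proof (induction k)
  case (Suc k)
  have "a ^ Suc k - b ^ Suc k = a * (a ^ k - b ^ k) + (a - b) * b ^ k"
    by (simp add: algebra_simps)
  also have "\<dots> \<le> a * (real k * a ^ (k - 1) * (a - b)) + (a - b) * a ^ k"
    using assms Suc by (intro add_mono mult_left_mono power_mono) auto
  also have "\<dots> = real (Suc k) * a ^ (Suc k - 1) * (a - b)"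
    by (cases k) (auto simp: algebra_simps)
  finally show ?case .
qed simp

lemma power_diff_ge:
  fixes a b :: real
  assumes "0 \<le> b" "b \<le> a" "k \<ge> 1"
  shows "(a - b) * a ^ (k - 1) \<le> a ^ k - b ^ k"
proof -
  obtain l where k: "k = Suc l" using assms(3) by (cases k) auto
  have "b * b ^ l \<le> b * a ^ l" using assms by (intro mult_left_mono power_mono) auto
  then show ?thesis by (simp add: k algebra_simps)
qed

text \<open>By the tangent at \<open>x\<close>, each term is at most
  the increment of \<open>x powr p\<close> over the unit interval to the left of \<open>x = b - j - 1\<close>, and the increments
  telescope.\<close>

lemma sum_powr_le_telescope:
  fixes b p :: real
  assumes "0 < p" "p \<le> 1" "real m + 1 \<le> b"
  shows "p * (\<Sum>j<m. (b - real j - 1) powr (p - 1)) \<le> (b - 1) powr p - (b - real m - 1) powr p"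
  using assms(3)
proof (induction m)
  case (Suc m)
  let ?x = "b - real m - 1"
  have "(?x - 1) powr p \<le> ?x powr p + p * ?x powr (p - 1) * (?x - 1 - ?x)"
    using Suc.prems assms by (intro powr_le_tangent) auto
  moreover have "?x - 1 = b - real (Suc m) - 1" by simp
  ultimately show ?case using Suc by (simp add: algebra_simps)
qed simp

section \<open>Vertical fibres of the shell\<close>

lemma powr_le_powr_iff:
  fixes a x y :: real
  assumes "a > 0" "x \<ge> 0" "y \<ge> 0"
  shows "x powr a \<le> y powr a \<longleftrightarrow> x \<le> y"
  using assms powr_mono2[of a x y] powr_less_mono2[of a y x] by linarith

lemma alpha_norm_le_iff:
  assumes "\<alpha> \<ge> 1" "b > 0"
  shows "alpha_norm \<alpha> (z, t) \<le> b \<longleftrightarrow> norm z ^ \<alpha> + \<bar>t\<bar> powr (real \<alpha> / 2) \<le> b ^ \<alpha>"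
    and "b \<le> alpha_norm \<alpha> (z, t) \<longleftrightarrow> b ^ \<alpha> \<le> norm z ^ \<alpha> + \<bar>t\<bar> powr (real \<alpha> / 2)"
proof -
  have "b = (b ^ \<alpha>) powr (1 / real \<alpha>)"
    using assms by (simp add: powr_powr flip: powr_realpow)
  then show "alpha_norm \<alpha> (z, t) \<le> b \<longleftrightarrow> norm z ^ \<alpha> + \<bar>t\<bar> powr (real \<alpha> / 2) \<le> b ^ \<alpha>"
    "b \<le> alpha_norm \<alpha> (z, t) \<longleftrightarrow> b ^ \<alpha> \<le> norm z ^ \<alpha> + \<bar>t\<bar> powr (real \<alpha> / 2)"
    using assms powr_le_powr_iff[of "1 / real \<alpha>" "norm z ^ \<alpha> + \<bar>t\<bar> powr (real \<alpha> / 2)" "b ^ \<alpha>"]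
      powr_le_powr_iff[of "1 / real \<alpha>" "b ^ \<alpha>" "norm z ^ \<alpha> + \<bar>t\<bar> powr (real \<alpha> / 2)"]
    by (simp_all add: alpha_norm_def)
qed

lemma abs_powr_half_le_iff:
  fixes c t :: real
  assumes "\<alpha> \<ge> 1" "c \<ge> 0"
  shows "\<bar>t\<bar> powr (real \<alpha> / 2) \<le> c \<longleftrightarrow> \<bar>t\<bar> \<le> c powr (2 / real \<alpha>)"
    and "c \<le> \<bar>t\<bar> powr (real \<alpha> / 2) \<longleftrightarrow> c powr (2 / real \<alpha>) \<le> \<bar>t\<bar>"
proof -
  have "(c powr (2 / real \<alpha>)) powr (real \<alpha> / 2) = c"
    using assms by (simp add: powr_powr)
  then show "\<bar>t\<bar> powr (real \<alpha> / 2) \<le> c \<longleftrightarrow> \<bar>t\<bar> \<le> c powr (2 / real \<alpha>)"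
    "c \<le> \<bar>t\<bar> powr (real \<alpha> / 2) \<longleftrightarrow> c powr (2 / real \<alpha>) \<le> \<bar>t\<bar>"
    using assms powr_le_powr_iff[of "real \<alpha> / 2" "\<bar>t\<bar>" "c powr (2 / real \<alpha>)"]
      powr_le_powr_iff[of "real \<alpha> / 2" "c powr (2 / real \<alpha>)" "\<bar>t\<bar>"]
    by simp_all
qed

definition vertical_fibre :: "nat \<Rightarrow> real \<Rightarrow> real \<Rightarrow> real ^ 'n \<Rightarrow> real set" where
  "vertical_fibre \<alpha> a b z = {t \<in> \<int>. a \<le> alpha_norm \<alpha> (z, t) \<and> alpha_norm \<alpha> (z, t) \<le> b}"

lemma vertical_fibre_subset:
  assumes "\<alpha> \<ge> 1" "0 < a" "0 < b" "norm z \<le> b"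
  shows "vertical_fibre \<alpha> a b z \<subseteq>
    {t. t \<in> \<int> \<and> (max 0 (a ^ \<alpha> - norm z ^ \<alpha>)) powr (2 / real \<alpha>) \<le> \<bar>t\<bar> \<and>
        \<bar>t\<bar> \<le> (b ^ \<alpha> - norm z ^ \<alpha>) powr (2 / real \<alpha>)}"
proof
  fix t assume t: "t \<in> vertical_fibre \<alpha> a b z"
  have nb: "norm z ^ \<alpha> \<le> b ^ \<alpha>" using assms by (intro power_mono) auto
  have "max 0 (a ^ \<alpha> - norm z ^ \<alpha>) \<le> \<bar>t\<bar> powr (real \<alpha> / 2)" "\<bar>t\<bar> powr (real \<alpha> / 2) \<le> b ^ \<alpha> - norm z ^ \<alpha>"
    using t assms by (auto simp: vertical_fibre_def alpha_norm_le_iff)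
  with t nb assms show "t \<in> {t. t \<in> \<int> \<and> (max 0 (a ^ \<alpha> - norm z ^ \<alpha>)) powr (2 / real \<alpha>) \<le> \<bar>t\<bar> \<and>
        \<bar>t\<bar> \<le> (b ^ \<alpha> - norm z ^ \<alpha>) powr (2 / real \<alpha>)}"
    using abs_powr_half_le_iff(1)[of \<alpha> "b ^ \<alpha> - norm z ^ \<alpha>" t]
      abs_powr_half_le_iff(2)[of \<alpha> "max 0 (a ^ \<alpha> - norm z ^ \<alpha>)" t]
    by (auto simp: vertical_fibre_def)
qed

lemma vertical_fibre_superset:
  assumes "\<alpha> \<ge> 1" "0 < a" "a \<le> b" "norm z \<le> a"
  shows "{t. t \<in> \<int> \<and> (a ^ \<alpha> - norm z ^ \<alpha>) powr (2 / real \<alpha>) \<le> t \<and>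
        t \<le> (b ^ \<alpha> - norm z ^ \<alpha>) powr (2 / real \<alpha>)} \<subseteq> vertical_fibre \<alpha> a b z"
proof
  fix t assume t: "t \<in> {t. t \<in> \<int> \<and> (a ^ \<alpha> - norm z ^ \<alpha>) powr (2 / real \<alpha>) \<le> t \<and>
        t \<le> (b ^ \<alpha> - norm z ^ \<alpha>) powr (2 / real \<alpha>)}"
  have na: "norm z ^ \<alpha> \<le> a ^ \<alpha>" "norm z ^ \<alpha> \<le> b ^ \<alpha>" using assms by (auto intro!: power_mono)
  have "0 \<le> (a ^ \<alpha> - norm z ^ \<alpha>) powr (2 / real \<alpha>)" by simp
  with t have t0: "\<bar>t\<bar> = t" using order_trans abs_of_nonneg by blast
  have "a ^ \<alpha> - norm z ^ \<alpha> \<le> \<bar>t\<bar> powr (real \<alpha> / 2)" "\<bar>t\<bar> powr (real \<alpha> / 2) \<le> b ^ \<alpha> - norm z ^ \<alpha>"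
    using t na assms by (simp_all only: abs_powr_half_le_iff diff_ge_0_iff_ge) (simp_all add: t0)
  with t assms show "t \<in> vertical_fibre \<alpha> a b z"
    by (simp add: vertical_fibre_def alpha_norm_le_iff)
qed

lemma finite_vertical_fibre:
  assumes "\<alpha> \<ge> 1" "0 < a" "0 < b" "norm z \<le> b"
  shows "finite (vertical_fibre \<alpha> a b z)"
  by (rule finite_subset[OF vertical_fibre_subset[OF assms] finite_Ints_abs_Icc])

text \<open>The summand 1 accounts for the end points. Summed over \<open>z\<close> it contributes
  \<open>O(R ^ D)\<close>, which is within the bound \<open>O(R ^ n * \<delta>)\<close> because \<open>R * \<delta> \<ge> 1\<close>.\<close>

lemma card_vertical_fibre_le:
  assumes "\<alpha> \<ge> 1" "0 < a" "a \<le> b" "norm z \<le> b"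
    and L: "(b ^ \<alpha> - norm z ^ \<alpha>) powr (2 / real \<alpha>) - (max 0 (a ^ \<alpha> - norm z ^ \<alpha>)) powr (2 / real \<alpha>) \<le> L"
  shows "real (card (vertical_fibre \<alpha> a b z)) \<le> 2 * (1 + L)"
proof -
  let ?lo = "(max 0 (a ^ \<alpha> - norm z ^ \<alpha>)) powr (2 / real \<alpha>)"
  let ?hi = "(b ^ \<alpha> - norm z ^ \<alpha>) powr (2 / real \<alpha>)"
  have "norm z ^ \<alpha> \<le> b ^ \<alpha>" "a ^ \<alpha> \<le> b ^ \<alpha>" using assms by (auto intro!: power_mono)
  then have lohi: "?lo \<le> ?hi" by (intro powr_mono2) auto
  have "card (vertical_fibre \<alpha> a b z) \<le> card {t::real. t \<in> \<int> \<and> ?lo \<le> \<bar>t\<bar> \<and> \<bar>t\<bar> \<le> ?hi}"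
    using assms by (intro card_mono finite_Ints_abs_Icc vertical_fibre_subset) auto
  then have "real (card (vertical_fibre \<alpha> a b z)) \<le> real (card {t::real. t \<in> \<int> \<and> ?lo \<le> \<bar>t\<bar> \<and> \<bar>t\<bar> \<le> ?hi})"
    by (rule of_nat_mono)
  also have "\<dots> \<le> 2 * (?hi - ?lo + 1)"
    by (rule card_Ints_abs_Icc_le[OF lohi])
  also have "\<dots> \<le> 2 * (1 + L)"
    using L by simp
  finally show ?thesis .
qed

text \<open>Subadditivity gives a bound for all \<open>z\<close>, including those for which the lower end of the fibre is cut
  off at 0. The bound for the length is attained when \<open>norm z = a\<close>.\<close>

lemma card_vertical_fibre_le_boundary:
  assumes "\<alpha> \<ge> 2" "0 < a" "a \<le> b" "norm z \<le> b"
  shows "real (card (vertical_fibre \<alpha> a b z)) \<le> 2 * (1 + (b ^ \<alpha> - a ^ \<alpha>) powr (2 / real \<alpha>))"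
proof (rule card_vertical_fibre_le)
  let ?x = "max 0 (a ^ \<alpha> - norm z ^ \<alpha>)"
  have nb: "norm z ^ \<alpha> \<le> b ^ \<alpha>" "a ^ \<alpha> \<le> b ^ \<alpha>" using assms by (auto intro!: power_mono)
  have "(b ^ \<alpha> - norm z ^ \<alpha>) powr (2 / real \<alpha>) \<le> (?x + (b ^ \<alpha> - a ^ \<alpha>)) powr (2 / real \<alpha>)"
    using nb by (intro powr_mono2) auto
  also have "\<dots> \<le> ?x powr (2 / real \<alpha>) + (b ^ \<alpha> - a ^ \<alpha>) powr (2 / real \<alpha>)"
    using nb assms by (intro powr_subadditive) auto
  finally show "(b ^ \<alpha> - norm z ^ \<alpha>) powr (2 / real \<alpha>) - ?x powr (2 / real \<alpha>) \<le> (b ^ \<alpha> - a ^ \<alpha>) powr (2 / real \<alpha>)"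
    by simp
qed (use assms in auto)

text \<open>At distance at least \<open>a - r\<close> from the sphere of radius \<open>a\<close> the function \<open>x powr p\<close> is evaluated away
  from its singularity, at some \<open>x \<ge> (a - r) * a ^ (\<alpha> - 1)\<close>, so the length of the fibre is linear in
  \<open>b ^ \<alpha> - a ^ \<alpha>\<close>.\<close>

lemma card_vertical_fibre_le_interior:
  assumes "\<alpha> \<ge> 2" "0 < a" "a \<le> b" "norm z \<le> r" "r < a"
  shows "real (card (vertical_fibre \<alpha> a b z)) \<le>
    2 * (1 + 2 / real \<alpha> * ((a - r) * a ^ (\<alpha> - 1)) powr (2 / real \<alpha> - 1) * (b ^ \<alpha> - a ^ \<alpha>))"
proof (rule card_vertical_fibre_le)
  define p x y where "p = 2 / real \<alpha>" and "x = a ^ \<alpha> - norm z ^ \<alpha>" and "y = (a - r) * a ^ (\<alpha> - 1)"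
  have p: "0 < p" "p \<le> 1" using assms by (auto simp: p_def)
  have "y \<le> (a - norm z) * a ^ (\<alpha> - 1)"
    unfolding y_def using assms by (intro mult_right_mono) auto
  also have "\<dots> \<le> x"
    unfolding x_def using assms by (intro power_diff_ge) auto
  finally have yx: "y \<le> x" .
  have y: "y > 0" using assms by (simp add: y_def)
  have ab: "a ^ \<alpha> \<le> b ^ \<alpha>" using assms by (auto intro!: power_mono)
  have "(x + (b ^ \<alpha> - a ^ \<alpha>)) powr p \<le> x powr p + p * x powr (p - 1) * (x + (b ^ \<alpha> - a ^ \<alpha>) - x)"
    using yx y ab p by (intro powr_le_tangent) auto
  also have "\<dots> \<le> x powr p + p * y powr (p - 1) * (b ^ \<alpha> - a ^ \<alpha>)"
    using yx y ab p by (simp add: mult_left_mono mult_right_mono powr_mono2')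
  finally have "(x + (b ^ \<alpha> - a ^ \<alpha>)) powr p - x powr p \<le> p * y powr (p - 1) * (b ^ \<alpha> - a ^ \<alpha>)"
    by simp
  moreover have "x + (b ^ \<alpha> - a ^ \<alpha>) = b ^ \<alpha> - norm z ^ \<alpha>" "max 0 (a ^ \<alpha> - norm z ^ \<alpha>) = x"
    using yx y by (auto simp: x_def)
  ultimately show "(b ^ \<alpha> - norm z ^ \<alpha>) powr (2 / real \<alpha>) - (max 0 (a ^ \<alpha> - norm z ^ \<alpha>)) powr (2 / real \<alpha>)
      \<le> 2 / real \<alpha> * ((a - r) * a ^ (\<alpha> - 1)) powr (2 / real \<alpha> - 1) * (b ^ \<alpha> - a ^ \<alpha>)"
    by (simp add: p_def y_def)
qed (use assms in auto)

text \<open>Over the origin, positive \<open>t\<close> range over \<open>[a\<^sup>2, b\<^sup>2]\<close>. The range over any other point is at least as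
  long, since increments of a concave function decrease.\<close>

lemma card_vertical_fibre_ge:
  assumes "\<alpha> \<ge> 2" "0 < a" "a \<le> b" "norm z < a"
  shows "b\<^sup>2 - a\<^sup>2 - 1 \<le> real (card (vertical_fibre \<alpha> a b z))"
proof -
  define p x where "p = 2 / real \<alpha>" and "x = a ^ \<alpha> - norm z ^ \<alpha>"
  have p: "0 < p" "p \<le> 1" using assms by (auto simp: p_def)
  have x: "0 < x" "x \<le> a ^ \<alpha>"
    unfolding x_def using assms by (auto intro!: power_strict_mono)
  have ab: "a ^ \<alpha> \<le> b ^ \<alpha>" using assms by (auto intro!: power_mono)
  have sq: "(c ^ \<alpha>) powr p = c\<^sup>2" if "c > 0" for c :: real
  proof -
    have "(c ^ \<alpha>) powr p = (c powr real \<alpha>) powr p" using that by (simp add: powr_realpow)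
    also have "\<dots> = c powr real 2" using assms by (simp add: powr_powr p_def)
    also have "\<dots> = c\<^sup>2" using that by (rule powr_realpow)
    finally show ?thesis .
  qed
  have "b\<^sup>2 - a\<^sup>2 = (a ^ \<alpha> + (b ^ \<alpha> - a ^ \<alpha>)) powr p - (a ^ \<alpha>) powr p"
    using sq[of a] sq[of b] assms by simp
  also have "\<dots> \<le> (x + (b ^ \<alpha> - a ^ \<alpha>)) powr p - x powr p"
    using x ab p by (intro powr_diff_antimono) auto
  also have "x + (b ^ \<alpha> - a ^ \<alpha>) = b ^ \<alpha> - norm z ^ \<alpha>"
    by (simp add: x_def)
  finally have "b\<^sup>2 - a\<^sup>2 \<le> (b ^ \<alpha> - norm z ^ \<alpha>) powr (2 / real \<alpha>) - (a ^ \<alpha> - norm z ^ \<alpha>) powr (2 / real \<alpha>)"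
    by (simp add: p_def x_def)
  moreover have "card {t. t \<in> \<int> \<and> (a ^ \<alpha> - norm z ^ \<alpha>) powr (2 / real \<alpha>) \<le> t \<and>
        t \<le> (b ^ \<alpha> - norm z ^ \<alpha>) powr (2 / real \<alpha>)} \<le> card (vertical_fibre \<alpha> a b z)"
    using assms by (intro card_mono vertical_fibre_superset finite_vertical_fibre) auto
  ultimately show ?thesis
    using card_Ints_Icc_ge[of "(b ^ \<alpha> - norm z ^ \<alpha>) powr (2 / real \<alpha>)" "(a ^ \<alpha> - norm z ^ \<alpha>) powr (2 / real \<alpha>)"]
    by linarith
qed

lemma vertical_fibre_mono:
  assumes "a \<le> a'" "b' \<le> b"
  shows "vertical_fibre \<alpha> a' b' z \<subseteq> vertical_fibre \<alpha> a b z"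
  using assms by (auto simp: vertical_fibre_def)

section \<open>Counting the shell\<close>

lemma lattice_shell_eq_Sigma:
  assumes "\<alpha> \<ge> 1" "R + \<delta> > 0"
  shows "(lattice_shell \<alpha> R \<delta> :: ((real ^ 'n) \<times> real) set) =
    (SIGMA z:{z \<in> int_vecs. norm z \<le> R + \<delta>}. vertical_fibre \<alpha> (R - \<delta>) (R + \<delta>) z)"
proof -
  have "norm z \<le> R + \<delta>" if "alpha_norm \<alpha> (z, t) \<le> R + \<delta>" for z :: "real ^ 'n" and t
  proof (rule power_le_imp_le_base)
    have "norm z ^ \<alpha> + \<bar>t\<bar> powr (real \<alpha> / 2) \<le> (R + \<delta>) ^ \<alpha>"
      using that assms by (simp add: alpha_norm_le_iff)
    then have "norm z ^ \<alpha> \<le> (R + \<delta>) ^ \<alpha>"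
      using powr_ge_zero[of "\<bar>t\<bar>" "real \<alpha> / 2"] by linarith
    then show "norm z ^ Suc (\<alpha> - 1) \<le> (R + \<delta>) ^ Suc (\<alpha> - 1)"
      using assms by simp
  qed (use assms in auto)
  then show ?thesis
    by (auto simp: lattice_shell_def int_lattice_def vertical_fibre_def int_vecs_def)
qed

lemma card_lattice_shell_eq_sum:
  assumes "\<alpha> \<ge> 1" "R - \<delta> > 0" "\<delta> \<ge> 0"
  shows "card (lattice_shell \<alpha> R \<delta> :: ((real ^ 'n) \<times> real) set) =
    (\<Sum>z | z \<in> int_vecs \<and> norm z \<le> R + \<delta>. card (vertical_fibre \<alpha> (R - \<delta>) (R + \<delta>) (z :: real ^ 'n)))"
proof -
  have "(\<forall>z\<in>{z \<in> int_vecs. norm z \<le> R + \<delta>}. finite (vertical_fibre \<alpha> (R - \<delta>) (R + \<delta>) (z :: real ^ 'n)))"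
    using assms by (auto intro!: finite_vertical_fibre)
  then show ?thesis
    using assms by (simp add: lattice_shell_eq_Sigma card_SigmaI finite_int_vecs_norm_le)
qed

text \<open>Only the outer half of the shell, between the radii \<open>R\<close> and \<open>R + \<delta>\<close>, is used. There the fibre over every \<open>z\<close>
  with \<open>norm z \<le> R / 2\<close> is at least \<open>2 * R * \<delta>\<close> long. Since \<open>R * \<delta> \<ge> 1\<close>, losing one
  integer to the end points still leaves \<open>R * \<delta>\<close> of them. The point \<open>z = 0\<close> alone carries the bound for \<open>R\<close> near 1.\<close>

lemma card_lattice_shell_ge:
  assumes "\<alpha> \<ge> 2" "R > 1" "0 < \<delta>" "\<delta> < 1" "1 \<le> R * \<delta>"
  shows "R ^ (CARD('n) + 1) * \<delta> \<le>
    (2 * real CARD('n)) ^ CARD('n) * real (card (lattice_shell \<alpha> R \<delta> :: ((real ^ 'n) \<times> real) set))"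
proof -
  let ?D = "real CARD('n)"
  let ?Z = "\<lambda>r. {z \<in> int_vecs :: (real ^ 'n) set. norm z \<le> r}"
  let ?V = "vertical_fibre \<alpha> (R - \<delta>) (R + \<delta>) :: real ^ 'n \<Rightarrow> _"
  have fibre: "R * \<delta> \<le> real (card (?V z))" if "z \<in> ?Z (R / 2)" for z
  proof -
    have "norm z < R" using that assms by auto
    then have "(R + \<delta>)\<^sup>2 - R\<^sup>2 - 1 \<le> real (card (vertical_fibre \<alpha> R (R + \<delta>) z))"
      using assms by (intro card_vertical_fibre_ge) auto
    moreover have "R * \<delta> \<le> (R + \<delta>)\<^sup>2 - R\<^sup>2 - 1"
      using assms by (simp add: power2_eq_square algebra_simps add_increasing)
    moreover have "card (vertical_fibre \<alpha> R (R + \<delta>) z) \<le> card (?V z)"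
      using assms \<open>norm z < R\<close> by (intro card_mono vertical_fibre_mono finite_vertical_fibre) auto
    ultimately show ?thesis by linarith
  qed
  have "(R / 2 / ?D) ^ CARD('n) * (R * \<delta>) \<le> real (card (?Z (R / 2))) * (R * \<delta>)"
    using assms by (intro mult_right_mono card_int_ball_ge) auto
  also have "\<dots> = (\<Sum>z\<in>?Z (R / 2). R * \<delta>)" by simp
  also have "\<dots> \<le> (\<Sum>z\<in>?Z (R / 2). real (card (?V z)))"
    by (intro sum_mono fibre)
  also have "\<dots> \<le> (\<Sum>z\<in>?Z (R + \<delta>). real (card (?V z)))"
    using assms by (intro sum_mono2 finite_int_vecs_norm_le) auto
  also have "\<dots> = real (card (lattice_shell \<alpha> R \<delta> :: ((real ^ 'n) \<times> real) set))"
    using assms by (simp add: card_lattice_shell_eq_sum)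
  finally show ?thesis
    by (simp add: field_simps power_divide power_mult_distrib)
qed

text \<open>Both uses have \<open>b - a = 2 * \<delta>\<close>. The parameter \<open>c\<close> is \<open>a\<close> in the interior estimate, where powers of \<open>a\<close>
  with an exponent of either sign have to cancel exactly, and \<open>R\<close> at the boundary.\<close>

lemma shell_height_le:
  assumes "\<alpha> \<ge> 1" "0 < a" "a \<le> b" "b \<le> 2 * c"
  shows "b ^ \<alpha> - a ^ \<alpha> \<le> real \<alpha> * 2 ^ (\<alpha> - 1) * c ^ (\<alpha> - 1) * (b - a)"
proof -
  have "b ^ \<alpha> - a ^ \<alpha> \<le> real \<alpha> * b ^ (\<alpha> - 1) * (b - a)"
    using assms by (intro power_diff_le) auto
  also have "\<dots> \<le> real \<alpha> * (2 * c) ^ (\<alpha> - 1) * (b - a)"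
    using assms by (intro mult_right_mono mult_left_mono power_mono) auto
  finally show ?thesis by (simp add: power_mult_distrib mult.assoc)
qed

text \<open>The base points \<open>z\<close> are grouped by \<open>j = \<lfloor>norm z\<rfloor>\<close>; each group has \<open>O(R ^ (D - 1))\<close> elements, so the sum over
  \<open>j\<close> of the longest fibre in each group has to be \<open>O(R\<^sup>2 * \<delta>)\<close>. In the interior this follows by
  telescoping. Only a bounded number of groups meet the boundary, and for these the hypothesis \<open>thick\<close> is
  exactly the condition under which \<open>(R ^ (\<alpha> - 1) * \<delta>) powr (2 / \<alpha>) \<le> R\<^sup>2 * \<delta>\<close>.\<close>

lemma card_lattice_shell_le:
  assumes "\<alpha> \<ge> 2" "R > 1" "0 < \<delta>" "\<delta> < 1" "1 \<le> R * \<delta>"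
    and thick: "R powr (- (2 / real \<alpha>)) \<le> \<delta> powr (1 - 2 / real \<alpha>)"
  shows "real (card (lattice_shell \<alpha> R \<delta> :: ((real ^ 'n) \<times> real) set)) \<le>
    real CARD('n) * (6 * real CARD('n) + 2) * 3 ^ (CARD('n) - 1) * 3 ^ (CARD('n) - 1)
      * (2 * (3 + 5 * (real \<alpha> * 2 ^ \<alpha>))) * (R ^ (CARD('n) + 1) * \<delta>)"
proof -
  define p a b h c where "p = 2 / real \<alpha>" and "a = R - \<delta>" and "b = R + \<delta>"
    and "h = b ^ \<alpha> - a ^ \<alpha>" and "c = real \<alpha> * 2 ^ \<alpha>"
  define K where "K = real CARD('n) * (6 * real CARD('n) + 2) * 3 ^ (CARD('n) - 1)"
  define M where "M = K * (3 * R) ^ (CARD('n) - 1)"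
  define m where "m = nat \<lfloor>a\<rfloor> - 1"
  define w where "w j = (if j < m then p * ((a - (real j + 1)) * a ^ (\<alpha> - 1)) powr (p - 1) * h else h powr p)" for j
  let ?Z = "{z \<in> int_vecs :: (real ^ 'n) set. norm z \<le> b}"
  let ?S = "\<lambda>j. {z \<in> int_vecs :: (real ^ 'n) set. real j \<le> norm z \<and> norm z < real j + 1}"
  let ?V = "vertical_fibre \<alpha> a b :: real ^ 'n \<Rightarrow> _"
  let ?J = "{..nat \<lfloor>b\<rfloor>}"
  have ab: "0 < a" "a < b" "b < a + 2" "b - a = 2 * \<delta>" "a \<le> R" "b \<le> 2 * R"
    using assms by (auto simp: a_def b_def)
  have p: "0 < p" "p \<le> 1" "real \<alpha> * p = 2" using assms by (auto simp: p_def)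
  have "1 * 1 \<le> real \<alpha> * 2 ^ \<alpha>" using assms by (intro mult_mono) auto
  then have c: "c \<ge> 1" by (simp add: c_def)
  have c2: "real \<alpha> * 2 ^ (\<alpha> - 1) * 2 = c"
    using assms by (cases \<alpha>) (auto simp: c_def)
  have pw: "x powr (real \<alpha> - 1) = x ^ (\<alpha> - 1)" if "x > 0" for x :: real
    using that assms(1) powr_realpow[of x "\<alpha> - 1"] by (simp add: of_nat_diff)
  have K: "K \<ge> 0" by (simp add: K_def)
  have h0: "h \<ge> 0" using ab by (simp add: h_def power_mono)
  have w0: "w j \<ge> 0" for j using h0 p ab by (simp add: w_def)
  have fibre: "real (card (?V z)) \<le> 2 * (1 + w (nat \<lfloor>norm z\<rfloor>))" if "norm z \<le> b" for z :: "real ^ 'n"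
  proof (cases "nat \<lfloor>norm z\<rfloor> < m")
    case True
    then have "norm z \<le> real (nat \<lfloor>norm z\<rfloor>) + 1" "real (nat \<lfloor>norm z\<rfloor>) + 1 < a"
      using ab unfolding m_def by linarith+
    then show ?thesis
      using card_vertical_fibre_le_interior[of \<alpha> a b z "real (nat \<lfloor>norm z\<rfloor>) + 1"] assms(1) ab True
      by (simp add: w_def p_def h_def)
  next
    case False
    then show ?thesis
      using card_vertical_fibre_le_boundary[of \<alpha> a b z] assms(1) ab that
      by (simp add: w_def p_def h_def)
  qed
  have shell: "real (card {z \<in> ?Z. nat \<lfloor>norm z\<rfloor> = j}) \<le> M" if "j \<in> ?J" for j
  proof -
    have "card {z \<in> ?Z. nat \<lfloor>norm z\<rfloor> = j} \<le> card (?S j)"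
    proof (rule card_mono)
      show "finite (?S j)"
        by (rule finite_subset[OF _ finite_int_vecs_norm_le[of "real j + 1"]]) auto
      show "{z \<in> ?Z. nat \<lfloor>norm z\<rfloor> = j} \<subseteq> ?S j"
        by auto
    qed
    also have "real (card (?S j)) \<le> K * (real j + 1) ^ (CARD('n) - 1)"
      unfolding K_def by (rule card_int_shell_le)
    also have "\<dots> \<le> M"
    proof -
      have "real j \<le> b" using that ab by (simp add: le_nat_iff le_floor_iff)
      then have "real j + 1 \<le> 3 * R" using assms by (simp add: b_def)
      then show ?thesis unfolding M_def using K by (intro mult_left_mono power_mono) auto
    qed
    finally show ?thesis by simp
  qed
  have "real (card (lattice_shell \<alpha> R \<delta> :: ((real ^ 'n) \<times> real) set)) = (\<Sum>z\<in>?Z. real (card (?V z)))"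
    using assms by (simp add: card_lattice_shell_eq_sum a_def b_def)
  also have "\<dots> \<le> (\<Sum>z\<in>?Z. 2 * (1 + w (nat \<lfloor>norm z\<rfloor>)))"
    by (intro sum_mono fibre) auto
  also have "\<dots> = (\<Sum>j\<in>?J. \<Sum>z\<in>{z \<in> ?Z. nat \<lfloor>norm z\<rfloor> = j}. 2 * (1 + w (nat \<lfloor>norm z\<rfloor>)))"
    by (intro sum.group[symmetric] finite_int_vecs_norm_le) (auto intro!: nat_mono floor_mono)
  also have "\<dots> = (\<Sum>j\<in>?J. real (card {z \<in> ?Z. nat \<lfloor>norm z\<rfloor> = j}) * (2 * (1 + w j)))"
    by (intro sum.cong) auto
  also have "\<dots> \<le> (\<Sum>j\<in>?J. M * (2 * (1 + w j)))"
    using w0 by (intro sum_mono mult_right_mono shell) auto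
  also have "\<dots> = 2 * M * (real (card ?J) + (\<Sum>j\<in>?J. w j))"
    by (simp add: sum_distrib_left sum.distrib algebra_simps)
  also have "\<dots> \<le> 2 * M * ((3 + 5 * c) * (R\<^sup>2 * \<delta>))"
  proof (intro mult_left_mono)
    have "real (card ?J) \<le> 3 * R" using assms by (simp add: b_def) linarith
    also have "\<dots> \<le> 3 * R * (R * \<delta>)" using assms by simp
    finally have J: "real (card ?J) \<le> 3 * (R\<^sup>2 * \<delta>)" by (simp add: power2_eq_square)
    have interior: "(\<Sum>j<m. w j) \<le> c * (R\<^sup>2 * \<delta>)"
    proof (cases "m = 0")
      case False
      then have m: "real m + 1 \<le> a" and a2: "a \<ge> 2" unfolding m_def using ab by linarith+
      have hle: "h \<le> c * \<delta> * a powr (real \<alpha> - 1)"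
        using shell_height_le[of \<alpha> a b a] ab a2 assms(1) c2
        by (simp add: h_def pw mult_ac flip: c2)
      have "(\<Sum>j<m. w j) = (\<Sum>j<m. h * (a ^ (\<alpha> - 1)) powr (p - 1) * (p * (a - real j - 1) powr (p - 1)))"
        by (intro sum.cong) (auto simp: w_def powr_mult diff_diff_eq mult_ac)
      also have "\<dots> = h * (a ^ (\<alpha> - 1)) powr (p - 1) * (p * (\<Sum>j<m. (a - real j - 1) powr (p - 1)))"
        by (simp add: sum_distrib_left)
      also have "\<dots> \<le> h * (a ^ (\<alpha> - 1)) powr (p - 1) * a powr p"
      proof (intro mult_left_mono)
        have "p * (\<Sum>j<m. (a - real j - 1) powr (p - 1)) \<le> (a - 1) powr p - (a - real m - 1) powr p"
          using p m by (intro sum_powr_le_telescope)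
        also have "\<dots> \<le> (a - 1) powr p" by simp
        also have "\<dots> \<le> a powr p" using p a2 by (intro powr_mono2) auto
        finally show "p * (\<Sum>j<m. (a - real j - 1) powr (p - 1)) \<le> a powr p" .
      qed (use h0 in auto)
      also have "\<dots> \<le> (c * \<delta> * a powr (real \<alpha> - 1)) * (a ^ (\<alpha> - 1)) powr (p - 1) * a powr p"
        by (intro mult_right_mono hle) auto
      also have "(a ^ (\<alpha> - 1)) powr (p - 1) = a powr ((real \<alpha> - 1) * (p - 1))"
        using pw[OF ab(1)] powr_powr[of a "real \<alpha> - 1" "p - 1"] by simp
      also have "(c * \<delta> * a powr (real \<alpha> - 1)) * a powr ((real \<alpha> - 1) * (p - 1)) * a powr p
          = c * \<delta> * a powr (real \<alpha> - 1 + (real \<alpha> - 1) * (p - 1) + p)"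
        by (simp add: powr_add)
      \<comment> \<open>The exponent of a collapses to \<alpha> p = 2.\<close>
      also have "real \<alpha> - 1 + (real \<alpha> - 1) * (p - 1) + p = real 2"
        using p(3) by (simp add: algebra_simps)
      also have "a powr real 2 = a\<^sup>2" using ab by (intro powr_realpow) auto
      also have "c * \<delta> * a\<^sup>2 \<le> c * \<delta> * R\<^sup>2"
        using ab c assms by (intro mult_left_mono power_mono) auto
      finally show ?thesis by (simp add: mult_ac)
    qed (use c assms in auto)
    have hp: "h powr p \<le> c * (R\<^sup>2 * \<delta>)"
    proof -
      have "h \<le> c * \<delta> * R powr (real \<alpha> - 1)"
        using shell_height_le[of \<alpha> a b R] ab assms(1,2) c2
        by (simp add: h_def pw mult_ac flip: c2)
      then have "h powr p \<le> (c * \<delta> * R powr (real \<alpha> - 1)) powr p"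
        using p h0 by (intro powr_mono2) auto
      also have "\<dots> = c powr p * \<delta> powr p * R powr ((real \<alpha> - 1) * p)"
        using c assms by (simp add: powr_mult powr_powr)
      also have "(real \<alpha> - 1) * p = real 2 + - p" using p(3) by (simp add: algebra_simps)
      also have "R powr (real 2 + - p) = R\<^sup>2 * R powr (- p)"
        unfolding powr_add using assms by (subst powr_realpow) auto
      also have "c powr p * \<delta> powr p * (R\<^sup>2 * R powr (- p)) \<le> c * \<delta> powr p * (R\<^sup>2 * \<delta> powr (1 - p))"
        using thick c p powr_mono[of p 1 c] by (intro mult_mono) (auto simp: p_def)
      also have "\<dots> = c * R\<^sup>2 * \<delta> powr (p + (1 - p))"
        unfolding powr_add by simp
      also have "\<delta> powr (p + (1 - p)) = \<delta>" using assms by simp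
      finally show ?thesis by (simp add: mult_ac)
    qed
    \<comment> \<open>As b < a + 2 and m \<ge> \<lfloor>a\<rfloor> - 1, at most four groups are not interior.\<close>
    have "?J \<subseteq> {..<m} \<union> {m..m + 3}"
    proof -
      have "nat \<lfloor>b\<rfloor> \<le> m + 3" using ab unfolding m_def by linarith
      then show ?thesis by auto
    qed
    then have "(\<Sum>j\<in>?J. w j) \<le> (\<Sum>j\<in>{..<m} \<union> {m..m + 3}. w j)"
      using w0 by (intro sum_mono2) auto
    also have "\<dots> = (\<Sum>j<m. w j) + (\<Sum>j\<in>{m..m + 3}. w j)"
      by (intro sum.union_disjoint) auto
    also have "(\<Sum>j\<in>{m..m + 3}. w j) = 4 * h powr p"
      by (simp add: w_def)
    finally show "real (card ?J) + (\<Sum>j\<in>?J. w j) \<le> (3 + 5 * c) * (R\<^sup>2 * \<delta>)"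
      using J interior hp by (simp add: algebra_simps)
  qed (use K assms in \<open>auto simp: M_def\<close>)
  also have "\<dots> = K * 3 ^ (CARD('n) - 1) * (2 * (3 + 5 * c)) * (R ^ (CARD('n) - 1) * R\<^sup>2 * \<delta>)"
    by (simp add: M_def power_mult_distrib)
  also have "R ^ (CARD('n) - 1) * R\<^sup>2 = R ^ (CARD('n) + 1)"
    by (simp flip: power_add)
  finally show ?thesis by (simp add: K_def c_def)
qed

text \<open>The three cases of the theorem differ only in the exponent \<open>\<kappa>\<close>. If \<open>\<delta> \<ge> R powr - \<kappa>\<close>, then
  \<open>\<kappa> \<le> 1\<close> gives \<open>R * \<delta> \<ge> 1\<close>, and \<open>\<kappa> * (\<alpha> - 2) \<le> 2\<close> gives the thickness condition of the upper bound.\<close>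

lemma sim_on_lattice_shell:
  fixes \<kappa> :: real
  assumes "\<alpha> \<ge> 2" "0 \<le> \<kappa>" "\<kappa> \<le> 1" "\<kappa> * (real \<alpha> - 2) \<le> 2"
  shows "sim_on {(R, \<delta>). R > 1 \<and> 0 \<le> \<delta> \<and> \<delta> < 1 \<and> \<delta> \<ge> R powr (- \<kappa>)}
    (\<lambda>(R, \<delta>). real (card (lattice_shell \<alpha> R \<delta> :: ((real ^ 'n) \<times> real) set)))
    (\<lambda>(R, \<delta>). R ^ (CARD('n) + 1) * \<delta>)"
proof -
  let ?P = "{(R::real, \<delta>). R > 1 \<and> 0 \<le> \<delta> \<and> \<delta> < 1 \<and> \<delta> \<ge> R powr (- \<kappa>)}"
  have pos: "\<delta> > 0" and thick1: "1 \<le> R * \<delta>"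
    and thick2: "R powr (- (2 / real \<alpha>)) \<le> \<delta> powr (1 - 2 / real \<alpha>)"
    if "R > 1" "\<delta> \<ge> R powr (- \<kappa>)" for R \<delta> :: real
  proof -
    have "0 < R powr (- \<kappa>)" using that by simp
    with that show "\<delta> > 0" by linarith
    have "1 = R * R powr (- 1)" using that by (simp add: powr_minus)
    also have "\<dots> \<le> R * R powr (- \<kappa>)" using that assms by (intro mult_left_mono powr_mono) auto
    also have "\<dots> \<le> R * \<delta>" using that by (intro mult_left_mono) auto
    finally show "1 \<le> R * \<delta>" .
    have "\<kappa> * (1 - 2 / real \<alpha>) = \<kappa> * (real \<alpha> - 2) / real \<alpha>" using assms by (simp add: field_simps)
    also have "\<dots> \<le> 2 / real \<alpha>" using assms by (intro divide_right_mono) auto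
    finally have "\<kappa> * (1 - 2 / real \<alpha>) \<le> 2 / real \<alpha>" .
    then have "R powr (- (2 / real \<alpha>)) \<le> R powr (- \<kappa> * (1 - 2 / real \<alpha>))"
      using that by (intro powr_mono) auto
    also have "\<dots> = (R powr (- \<kappa>)) powr (1 - 2 / real \<alpha>)" by (simp add: powr_powr)
    also have "\<dots> \<le> \<delta> powr (1 - 2 / real \<alpha>)"
      using that assms by (intro powr_mono2) auto
    finally show "R powr (- (2 / real \<alpha>)) \<le> \<delta> powr (1 - 2 / real \<alpha>)" .
  qed
  show ?thesis
    unfolding sim_on_def lesssim_on_def
  proof (intro conjI exI ballI)
    fix x assume "x \<in> ?P"
    then obtain R \<delta> where x: "x = (R, \<delta>)" "R > 1" "\<delta> < 1" "\<delta> \<ge> R powr (- \<kappa>)" by auto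
    show "(case x of (R, \<delta>) \<Rightarrow> real (card (lattice_shell \<alpha> R \<delta> :: ((real ^ 'n) \<times> real) set)))
      \<le> real CARD('n) * (6 * real CARD('n) + 2) * 3 ^ (CARD('n) - 1) * 3 ^ (CARD('n) - 1)
        * (2 * (3 + 5 * (real \<alpha> * 2 ^ \<alpha>))) * (case x of (R, \<delta>) \<Rightarrow> R ^ (CARD('n) + 1) * \<delta>)"
      unfolding x(1) prod.case
      using card_lattice_shell_le[OF assms(1) x(2) pos x(3) thick1 thick2] x by blast
    show "(case x of (R, \<delta>) \<Rightarrow> R ^ (CARD('n) + 1) * \<delta>) \<le> (2 * real CARD('n)) ^ CARD('n)
        * (case x of (R, \<delta>) \<Rightarrow> real (card (lattice_shell \<alpha> R \<delta> :: ((real ^ 'n) \<times> real) set)))"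
      unfolding x(1) prod.case
      using card_lattice_shell_ge[OF assms(1) x(2) pos x(3) thick1] x by blast
  next
    show "0 < real CARD('n) * (6 * real CARD('n) + 2) * 3 ^ (CARD('n) - 1) * 3 ^ (CARD('n) - 1)
        * (2 * (3 + 5 * (real \<alpha> * 2 ^ \<alpha>)))"
      by (intro mult_pos_pos add_pos_nonneg) auto
  qed auto
qed

theorem proposition5p1:
  fixes d \<alpha> n :: nat
  assumes "CARD('n::finite) = 2 * d"
    and "d \<ge> 1" and "\<alpha> \<ge> 2" and "n = 2 * d + 1"
  defines "N \<equiv> \<lambda>(R, \<delta>). real (card (lattice_shell \<alpha> R \<delta> :: ((real ^ 'n) \<times> real) set))"
    and "V \<equiv> \<lambda>(R :: real, \<delta> :: real). R ^ n * \<delta>"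
  shows
    "(\<alpha> \<ge> 2 * (n - 1) \<longrightarrow>
        sim_on {(R, \<delta>). R > 1 \<and> 0 \<le> \<delta> \<and> \<delta> < 1 \<and> \<delta> \<ge> R powr (- (1 / (real \<alpha> - 1)))} N V) \<and>
     (2 < \<alpha> \<and> \<alpha> \<le> 2 * (n - 1) \<longrightarrow>
        sim_on {(R, \<delta>). R > 1 \<and> 0 \<le> \<delta> \<and> \<delta> < 1 \<and> \<delta> \<ge> R powr (- (1 / (2 * real n - 3)))} N V) \<and>
     (\<alpha> = 2 \<longrightarrow>
        sim_on {(R, \<delta>). R > 1 \<and> 0 \<le> \<delta> \<and> \<delta> < 1 \<and> \<delta> \<ge> R powr (- ((real n - 2) / real n))} N V)"
proof -
  have V: "V = (\<lambda>(R, \<delta>). R ^ (CARD('n) + 1) * \<delta>)"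
    using assms(1,4) by (simp add: V_def)
  have n: "real n \<ge> 3" using assms(2,4) by simp
  have sim: "sim_on {(R, \<delta>). R > 1 \<and> 0 \<le> \<delta> \<and> \<delta> < 1 \<and> \<delta> \<ge> R powr (- \<kappa>)} N V"
    if "0 \<le> \<kappa>" "\<kappa> \<le> 1" "\<kappa> * (real \<alpha> - 2) \<le> 2" for \<kappa>
    unfolding V N_def using assms(3) that by (rule sim_on_lattice_shell)
  show ?thesis
  proof (intro conjI impI sim)
    show "1 / (real \<alpha> - 1) * (real \<alpha> - 2) \<le> 2" using assms(3) by (simp add: field_simps)
    assume "2 < \<alpha> \<and> \<alpha> \<le> 2 * (n - 1)"
    then have "real \<alpha> \<le> 2 * (real n - 1)" using assms(2,4) by (simp add: algebra_simps)
    then show "1 / (2 * real n - 3) * (real \<alpha> - 2) \<le> 2" using n by (simp add: field_simps)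
  qed (use assms(3) n in auto)
qed

end
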